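(* For every integer $n\ge 0$ the following identities hold: (a) $\mathcal{K}_{-n}=3\mathcal{T}_{-n+1}-2\mathcal{T}_{-n}-\mathcal{T}_{-n-1}$; (b) $\mathcal{K}_{-n}=\mathcal{T}_{-n}+2\mathcal{T}_{-n-1}+3\mathcal{T}_{-n-2}$; (c) $\mathcal{K}_{-n}=-\mathcal{T}_{-n+2}+4\mathcal{T}_{-n+1}-\mathcal{T}_{-n}$; (d) $\mathcal{T}_{-n}=\frac{1}{22}\left(5\mathcal{K}_{-n+2}-3\mathcal{K}_{-n+1}-4\mathcal{K}_{-n}\right)$.
   Context: The Tribonacci matrix sequence $(\mathcal{T}_n)_{n\in\mathbb{Z}}$ and Tribonacci-Lucas matrix sequence $(\mathcal{K}_n)_{n\in\mathbb{Z}}$ are the sequences of $3\times 3$ matrices satisfying $\mathcal{T}_n=\mathcal{T}_{n-1}+\mathcal{T}_{n-2}+\mathcal{T}_{n-3}$ and $\mathcal{K}_n=\mathcal{K}_{n-1}+\mathcal{K}_{n-2}+\mathcal{K}_{n-3}$ for all integers $n$ (extended to negative indices by running the recurrence backwards), with $$\mathcal{T}_{0}=I_3,\quad \mathcal{T}_{1}=\begin{pmatrix}1&1&1\\1&0&0\\0&1&0\end{pmatrix},\quad \mathcal{T}_{2}=\begin{pmatrix}2&2&1\\1&1&1\\1&0&0\end{pmatrix},$$ $$\mathcal{K}_{0}=\begin{pmatrix}1&2&3\\3&-2&-1\\-1&4&-1\end{pmatrix},\quad \mathcal{K}_{1}=\begin{pmatrix}3&4&1\\1&2&3\\3&-2&-1\end{pmatrix},\quad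 \mathcal{K}_{2}=\begin{pmatrix}7&4&3\\3&4&1\\1&2&3\end{pmatrix}.$$ *)

theory Defs
  imports "HOL-Analysis.Analysis"
begin

text \<open>The two-sided sequence with values \<open>a\<close>, \<open>b\<close>, \<open>c\<close> at the indices 0, 1, 2 that satisfies the
  Tribonacci recurrence at every integer. Below index 0 the recurrence is solved for its last
  term; \<open>tribonacci_rec\<close> and \<open>tribonacci_unique\<close> show that this is the intended sequence.\<close>

function tribonacci :: "'a::ab_group_add \<Rightarrow> 'a \<Rightarrow> 'a \<Rightarrow> int \<Rightarrow> 'a" where
  "tribonacci a b c n =
    (if n < 0 then
       tribonacci a b c (n + 3) - tribonacci a b c (n + 2) - tribonacci a b c (n + 1)
     else if n = 0 then a
     else if n = 1 then b
     else if n = 2 then c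
     else tribonacci a b c (n - 1) + tribonacci a b c (n - 2) + tribonacci a b c (n - 3))"
  by pat_completeness auto
termination
  by (relation "Wellfounded.measure (\<lambda>(a, b, c, n). nat (if n \<ge> 0 then n else 2 - n))") auto

declare tribonacci.simps [simp del]

lemma tribonacci_init [simp]:
  "tribonacci a b c 0 = a" "tribonacci a b c 1 = b" "tribonacci a b c 2 = c"
  by (simp_all add: tribonacci.simps)

lemma tribonacci_rec:
  "tribonacci a b c n =
     tribonacci a b c (n - 1) + tribonacci a b c (n - 2) + tribonacci a b c (n - 3)"
proof (cases "n \<ge> 3")
  case True
  then show ?thesis by (subst tribonacci.simps) simp
next
  case False
  then have "tribonacci a b c (n - 3) =
      tribonacci a b c n - tribonacci a b c (n - 1) - tribonacci a b c (n - 2)"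
    by (subst tribonacci.simps) simp
  then show ?thesis by simp
qed

lemma tribonacci_unique:
  assumes "\<And>n::int. f n = f (n - 1) + f (n - 2) + f (n - 3)"
  shows "f n = tribonacci (f 0) (f 1) (f 2) n"
proof (induction "nat (if n \<ge> 0 then n else 2 - n)" arbitrary: n rule: less_induct)
  case less
  consider "n < 0" | "n = 0" | "n = 1" | "n = 2" | "n > 2" by linarith
  then show ?case
  proof cases
    case 1
    have "f n = f (n + 3) - f (n + 2) - f (n + 1)"
      using assms[of "n + 3"] by (simp add: algebra_simps)
    with 1 show ?thesis
      using less[of "n + 1"] less[of "n + 2"] less[of "n + 3"]
      by (simp add: tribonacci.simps[of _ _ _ n])
  next
    case 5
    then show ?thesis
      using less[of "n - 1"] less[of "n - 2"] less[of "n - 3"] assms[of n]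
      by (simp add: tribonacci_rec[of _ _ _ n])
  qed simp_all
qed

definition tribonacci_matrix :: "int \<Rightarrow> real^3^3" (\<open>\<T>\<close>) where
  "\<T> = tribonacci
     (mat 1)
     (vector [vector [1, 1, 1],
              vector [1, 0, 0],
              vector [0, 1, 0]])
     (vector [vector [2, 2, 1],
              vector [1, 1, 1],
              vector [1, 0, 0]])"

definition tribonacci_lucas_matrix :: "int \<Rightarrow> real^3^3" (\<open>\<K>\<close>) where
  "\<K> = tribonacci
     (vector [vector [ 1,  2,  3],
              vector [ 3, -2, -1],
              vector [-1,  4, -1]])
     (vector [vector [ 3,  4,  1],
              vector [ 1,  2,  3],
              vector [ 3, -2, -1]])
     (vector [vector [ 7,  4,  3],
              vector [ 3,  4,  1],
              vector [ 1,  2,  3]])"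

end

theory Submission
  imports Defs
begin

text \<open>The solutions of the Tribonacci recurrence on the integers form a vector space that is closed
  under index shifts, and a solution is determined by its values at 0, 1, 2. So each of the four
  identities, which equate shift combinations of \<open>\<T>\<close> and \<open>\<K>\<close>, holds at every integer index as
  soon as it holds at three of them.

  Only identity (c) needs such a check of matrices (\<open>tribonacci_lucas_matrix_eq\<close>). The other three
  are linear consequences of it: the recurrence for \<open>\<T>\<close> rewrites the right-hand side of (c) into
  those of (a) and (b), and it reduces the right-hand side of (d), once (c) has eliminated \<open>\<K>\<close>, to
  a multiple of a single \<open>\<T>\<close>. The factor 22 is the one for which this multiple is 1: modulo the
  characteristic polynomial \<open>x\<^sup>3 - x\<^sup>2 - x - 1\<close> one has
  \<open>(5x\<^sup>2 - 3x - 4)(-x\<^sup>2 + 4x - 1) = 22\<close>, so (c) and (d) are inverse to each other.\<close>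

lemma tribonacci_matrix_rec: "\<T> n = \<T> (n - 1) + \<T> (n - 2) + \<T> (n - 3)"
  unfolding tribonacci_matrix_def by (rule tribonacci_rec)

lemma tribonacci_matrix_rec_add3: "\<T> (n + 3) = \<T> (n + 2) + \<T> (n + 1) + \<T> n"
  using tribonacci_matrix_rec[of "n + 3"] by (simp add: add.commute)

lemma tribonacci_matrix_init:
  "\<T> 0 = mat 1"
  "\<T> 1 = vector [vector [1, 1, 1], vector [1, 0, 0], vector [0, 1, 0]]"
  "\<T> 2 = vector [vector [2, 2, 1], vector [1, 1, 1], vector [1, 0, 0]]"
  by (simp_all add: tribonacci_matrix_def)

text \<open>Both sides solve the recurrence, so the indices 0, 1, 2 suffice; at these indices the
  right-hand side involves \<open>\<T> 0\<close> up to \<open>\<T> 4\<close>.\<close>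

lemma tribonacci_lucas_matrix_eq: "\<K> n = - \<T> (n + 2) + 4 *\<^sub>R \<T> (n + 1) - \<T> n"
proof -
  define f where "f n = - \<T> (n + 2) + 4 *\<^sub>R \<T> (n + 1) - \<T> n" for n
  have "f n = f (n - 1) + f (n - 2) + f (n - 3)" for n
    using tribonacci_matrix_rec[of "n + 2"] tribonacci_matrix_rec[of "n + 1"]
      tribonacci_matrix_rec[of n]
    by (simp add: f_def algebra_simps)
  then have f: "f n = tribonacci (f 0) (f 1) (f 2) n"
    by (rule tribonacci_unique)
  have T3: "\<T> 3 = \<T> 2 + \<T> 1 + \<T> 0" and T4: "\<T> 4 = \<T> 3 + \<T> 2 + \<T> 1"
    using tribonacci_matrix_rec[of 3] tribonacci_matrix_rec[of 4] by simp_all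
  have "f 0 = \<K> 0" "f 1 = \<K> 1" "f 2 = \<K> 2"
    by (simp_all add: f_def T4 T3 tribonacci_matrix_init tribonacci_lucas_matrix_def
        vec_eq_iff forall_3 mat_def)
  then show ?thesis
    using f by (simp add: f_def tribonacci_lucas_matrix_def)
qed

theorem theorem3p1:
  fixes n :: int
  assumes "n \<ge> 0"
  shows "\<K> (-n) = 3 *\<^sub>R \<T> (-n + 1) - 2 *\<^sub>R \<T> (-n) - \<T> (-n - 1)
       \<and> \<K> (-n) = \<T> (-n) + 2 *\<^sub>R \<T> (-n - 1) + 3 *\<^sub>R \<T> (-n - 2)
       \<and> \<K> (-n) = - \<T> (-n + 2) + 4 *\<^sub>R \<T> (-n + 1) - \<T> (-n)
       \<and> \<T> (-n) = (1 / 22) *\<^sub>R (5 *\<^sub>R \<K> (-n + 2) - 3 *\<^sub>R \<K> (-n + 1) - 4 *\<^sub>R \<K> (-n))"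
proof -
  define m where "m = - n"
  have c: "\<K> m = - \<T> (m + 2) + 4 *\<^sub>R \<T> (m + 1) - \<T> m"
    by (rule tribonacci_lucas_matrix_eq)
  have T2: "\<T> (m + 2) = \<T> (m + 1) + \<T> m + \<T> (m - 1)"
    using tribonacci_matrix_rec_add3[of "m - 1"] by (simp add: add.commute)
  have T1: "\<T> (m + 1) = \<T> m + \<T> (m - 1) + \<T> (m - 2)"
    using tribonacci_matrix_rec_add3[of "m - 2"] by (simp add: add.commute)
  have a: "\<K> m = 3 *\<^sub>R \<T> (m + 1) - 2 *\<^sub>R \<T> m - \<T> (m - 1)"
    unfolding c T2 by (simp add: vec_eq_iff)
  have b: "\<K> m = \<T> m + 2 *\<^sub>R \<T> (m - 1) + 3 *\<^sub>R \<T> (m - 2)"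
    unfolding a T1 by (simp add: vec_eq_iff)
  have T3: "\<T> (m + 3) = \<T> (m + 2) + \<T> (m + 1) + \<T> m"
    by (rule tribonacci_matrix_rec_add3)
  have T4: "\<T> (m + 4) = \<T> (m + 3) + \<T> (m + 2) + \<T> (m + 1)"
    using tribonacci_matrix_rec_add3[of "m + 1"] by (simp add: add.commute)
  have K1: "\<K> (m + 1) = - \<T> (m + 3) + 4 *\<^sub>R \<T> (m + 2) - \<T> (m + 1)"
    using tribonacci_lucas_matrix_eq[of "m + 1"] by (simp add: add.commute)
  have K2: "\<K> (m + 2) = - \<T> (m + 4) + 4 *\<^sub>R \<T> (m + 3) - \<T> (m + 2)"
    using tribonacci_lucas_matrix_eq[of "m + 2"] by (simp add: add.commute)
  have d: "\<T> m = (1 / 22) *\<^sub>R (5 *\<^sub>R \<K> (m + 2) - 3 *\<^sub>R \<K> (m + 1) - 4 *\<^sub>R \<K> m)"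
    unfolding K2 K1 c T4 T3 by (simp add: vec_eq_iff algebra_simps)
  show ?thesis
    using a b c d unfolding m_def by blast
qed

end
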